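(* Let $R$ be a connected quantized Weyl algebra over $\mathbb{K}$ generated by $x_1,x_2,\dots,x_n$ with parameters $q_{ij}$ and $r_{ij}$ ($1\leq i\neq j\leq n$). Then there exists $q\in\mathbb{K}^*$ such that $\{q_{ij}:1\leq i\neq j\leq n\}=\{q,q^{-1}\}$.
   Context: $\mathbb{K}$ is an algebraically closed field and $\mathbb{K}^*=\mathbb{K}\setminus\{0\}$. A connected quantized Weyl algebra over $\mathbb{K}$ is an associative unital $\mathbb{K}$-algebra $R$ with generators $x_1,\dots,x_n$, $n\geq 2$, such that: (i) there are scalars $q_{ij}\in\mathbb{K}^*$ and $r_{ij}\in\mathbb{K}$, $1\leq i\neq j\leq n$, with $q_{ji}=q_{ij}^{-1}$ and $r_{ji}=-q_{ij}^{-1}r_{ij}$, such that $x_ix_j=q_{ij}x_jx_i+r_{ij}$ for all $i\neq j$; (ii) the standard monomials $x_1^{a_1}x_2^{a_2}\cdots x_n^{a_n}$ ($a_i\geq 0$) form a $\mathbb{K}$-basis of $R$; (iii) the graph with vertices $x_1,\dots,x_n$, in which there is an edge between $x_i$ and $x_j$ if and only if $r_{ij}\neq 0$, is connected. *)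

theory Defs
  imports
    "HOL-Library.FuncSet"
    "HOL-Computational_Algebra.Polynomial"
    "Graph_Theory.Graph_Theory"
begin

locale unital_algebra = vector_space scale
  for scale :: "'k::field \<Rightarrow> 'a::ring_1 \<Rightarrow> 'a" (infixr \<open>*s\<close> 75) +
  assumes scale_mult_left: "(c *s a) * b = c *s (a * b)"
    and scale_mult_right: "a * (c *s b) = c *s (a * b)"
begin

definition subalgebra :: "'a set \<Rightarrow> bool" where
  "subalgebra S \<longleftrightarrow> subspace S \<and> 1 \<in> S \<and> (\<forall>a\<in>S. \<forall>b\<in>S. a * b \<in> S)"

end

text \<open>The product is taken in increasing order of the index, since the generators do not commute.\<close>

definition standard_monomial :: "nat \<Rightarrow> (nat \<Rightarrow> 'a::monoid_mult) \<Rightarrow> (nat \<Rightarrow> nat) \<Rightarrow> 'a" where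
  "standard_monomial n x a = (\<Prod>i\<leftarrow>[1..<Suc n]. x i ^ a i)"

text \<open>
  Exponent vectors are extensional functions on \<open>{1..n}\<close>, so that each vector has exactly
  one representative and injectivity of the monomial map is meaningful.
\<close>

definition exponents :: "nat \<Rightarrow> (nat \<Rightarrow> nat) set" where
  "exponents n = {1..n} \<rightarrow>\<^sub>E UNIV"

text \<open>The vertex \<open>i\<close> stands for the generator \<open>x i\<close>.\<close>

definition weyl_graph :: "nat \<Rightarrow> (nat \<Rightarrow> nat \<Rightarrow> 'k::zero) \<Rightarrow> nat pair_pre_digraph" where
  "weyl_graph n r =
     \<lparr> pverts = {1..n},
       parcs = {(i, j). i \<in> {1..n} \<and> j \<in> {1..n} \<and> i \<noteq> j \<and> r i j \<noteq> 0} \<rparr>"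

text \<open>
  The values of \<open>q\<close> and \<open>r\<close> on the diagonal and outside \<open>{1..n}\<close> are irrelevant.
  The standard monomials form a basis as a family, so distinct exponent vectors are required to
  give distinct monomials.
\<close>

locale connected_quantized_weyl_algebra = unital_algebra scale
  for scale :: "'k::alg_closed_field \<Rightarrow> 'a::ring_1 \<Rightarrow> 'a" (infixr \<open>*s\<close> 75) +
  fixes n :: nat
    and x :: "nat \<Rightarrow> 'a"
    and q r :: "nat \<Rightarrow> nat \<Rightarrow> 'k"
  assumes n_ge_2: "n \<ge> 2"
    and generators: "subalgebra hull (x ` {1..n}) = UNIV"
    and q_nonzero: "\<lbrakk>i \<in> {1..n}; j \<in> {1..n}; i \<noteq> j\<rbrakk> \<Longrightarrow> q i j \<noteq> 0"
    and q_swap: "\<lbrakk>i \<in> {1..n}; j \<in> {1..n}; i \<noteq> j\<rbrakk> \<Longrightarrow> q j i = inverse (q i j)"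
    and r_swap: "\<lbrakk>i \<in> {1..n}; j \<in> {1..n}; i \<noteq> j\<rbrakk> \<Longrightarrow> r j i = - (inverse (q i j) * r i j)"
    and relation: "\<lbrakk>i \<in> {1..n}; j \<in> {1..n}; i \<noteq> j\<rbrakk> \<Longrightarrow>
                     x i * x j = q i j *s (x j * x i) + r i j *s 1"
    and monomials_inj: "inj_on (standard_monomial n x) (exponents n)"
    and monomials_independent: "independent (standard_monomial n x ` exponents n)"
    and monomials_span: "span (standard_monomial n x ` exponents n) = UNIV"
    and graph_connected: "Digraph_Component.connected (with_proj (weyl_graph n r))"

end

theory Submission
  imports Defs
begin

text \<open>
  Reordering \<open>x i * x j * x k\<close> in two ways and comparing coefficients gives
  \<open>q i j * q i k = 1\<close> whenever \<open>j\<close> and \<open>k\<close> are adjacent and \<open>i\<close> is a third index. So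
  the unordered pair \<open>{q i j, q j i}\<close> does not change when one of two tokens on distinct vertices
  \<open>i\<close>, \<open>j\<close> slides along an edge to a free vertex. In a connected graph any placement of
  two indistinguishable tokens can be reached from any other by such slides.
\<close>

lemma all_pairs_by_sliding:
  assumes E_verts: "E \<subseteq> V \<times> V" and E_irrefl: "\<And>u. (u, u) \<notin> E" and E_sym: "sym E"
    and conn: "\<And>u v. \<lbrakk>u \<in> V; v \<in> V\<rbrakk> \<Longrightarrow> (u, v) \<in> E\<^sup>*"
    and P_sym: "\<And>i j. \<lbrakk>i \<in> V; j \<in> V; i \<noteq> j; P i j\<rbrakk> \<Longrightarrow> P j i"
    and slide: "\<And>i j k. \<lbrakk>i \<in> V; (j, k) \<in> E; i \<noteq> j; i \<noteq> k; P i j\<rbrakk> \<Longrightarrow> P i k"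
    and ab: "(a, b) \<in> E" "P a b"
    and uv: "u \<in> V" "v \<in> V" "u \<noteq> v"
  shows "P u v"
proof -
  have edgeD: "i \<in> V" "j \<in> V" "i \<noteq> j" "(j, i) \<in> E" if "(i, j) \<in> E" for i j
    using that E_verts E_irrefl E_sym by (auto dest: symD)
  \<comment> \<open>Here \<open>j\<close> and \<open>k\<close> need not be adjacent, so the token on
    \<open>j\<close> cannot slide straight to \<open>k\<close>. Instead the token on
    \<open>i\<close> moves to \<open>k\<close>, and the one on \<open>j\<close> then moves into the
    vacated \<open>i\<close>.\<close>
  have share: "P i k" if "(i, j) \<in> E" "P i j" "(i, k) \<in> E" for i j k
  proof (cases "k = j")
    case False
    have "P j k"
      using slide[of j i k] P_sym[of i j] that edgeD[OF that(1)] edgeD[OF that(3)] False by metis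
    then show ?thesis
      using slide[of k j i] P_sym[of j k] P_sym[of k i] edgeD[OF that(1)] edgeD[OF that(3)] False
      by metis
  qed (use that in simp)
  \<comment> \<open>Induction along a walk from \<open>a\<close>: crossing an arc
    \<open>(y, z)\<close> gives \<open>P z y\<close>, and \<open>share\<close> spreads it to all
    arcs at \<open>z\<close>.\<close>
  have edges: "\<forall>w. (u, w) \<in> E \<longrightarrow> P u w"
    using conn[OF edgeD(1)[OF ab(1)] uv(1)]
  proof (induction rule: rtrancl_induct)
    case base
    show ?case using share ab by blast
  next
    case (step y z)
    have "P z y"
      using step.IH step.hyps(2) edgeD[OF step.hyps(2)] P_sym[of y z] by simp
    then show ?case using share edgeD(4)[OF step.hyps(2)] by blast
  qed
  \<comment> \<open>One token stays on \<open>u\<close> while the other follows a walk to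
    \<open>v\<close>. The walk may return to \<open>u\<close>, hence the implication; a step leaving
    \<open>u\<close> is covered by \<open>edges\<close>.\<close>
  have "u \<noteq> v \<longrightarrow> P u v"
    using conn[OF uv(1,2)]
  proof (induction rule: rtrancl_induct)
    case (step y z)
    then show ?case using edges slide[of u y z] uv(1) by metis
  qed simp
  then show ?thesis using uv(3) by simp
qed

lemma prod_list_map_single:
  fixes f :: "'b \<Rightarrow> 'a::monoid_mult"
  assumes "distinct l" "k \<in> set l" "\<And>i. i \<in> set l \<Longrightarrow> i \<noteq> k \<Longrightarrow> f i = 1"
  shows "prod_list (map f l) = f k"
proof -
  have one: "prod_list (map f l) = 1" if "\<forall>i\<in>set l. f i = 1" for l
    using that by (induction l) auto
  show ?thesis using assms
  proof (induction l)
    case (Cons y l)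
    show ?case
    proof (cases "y = k")
      case True
      then have "\<forall>i\<in>set l. f i = 1" using Cons.prems by auto
      then show ?thesis using one True by simp
    next
      case False
      then show ?thesis using Cons by simp
    qed
  qed simp
qed

text \<open>The standard basis vector of index \<open>k\<close>, made extensional so that it lies in
  \<open>exponents n\<close>.\<close>

definition unit_exponent :: "nat \<Rightarrow> nat \<Rightarrow> nat \<Rightarrow> nat" where
  "unit_exponent n k = (\<lambda>i\<in>{1..n}. if i = k then 1 else 0)"

lemma unit_exponent_in_exponents: "unit_exponent n k \<in> exponents n"
  by (simp add: unit_exponent_def exponents_def)

lemma standard_monomial_unit_exponent:
  assumes "k \<in> {1..n}"
  shows "standard_monomial n x (unit_exponent n k) = x k"
proof -
  have "(\<Prod>i\<leftarrow>[1..<Suc n]. x i ^ unit_exponent n k i) = x k ^ unit_exponent n k k"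
    by (rule prod_list_map_single) (use assms in \<open>auto simp: unit_exponent_def\<close>)
  then show ?thesis
    using assms by (simp add: standard_monomial_def unit_exponent_def)
qed

lemma unit_exponent_eq_iff:
  assumes "i \<in> {1..n}"
  shows "unit_exponent n i = unit_exponent n j \<longleftrightarrow> i = j"
  using assms by (auto simp: unit_exponent_def fun_eq_iff restrict_def)

context connected_quantized_weyl_algebra
begin

lemma generators_in_basis: "x ` {1..n} \<subseteq> standard_monomial n x ` exponents n"
proof
  fix y assume "y \<in> x ` {1..n}"
  then obtain k where "k \<in> {1..n}" "y = x k" by blast
  then have "y = standard_monomial n x (unit_exponent n k)"
    by (simp only: standard_monomial_unit_exponent)
  then show "y \<in> standard_monomial n x ` exponents n"
    using unit_exponent_in_exponents by blast
qed

text \<open>Independence of the image set alone would not exclude coinciding generators; injectivity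
  of the monomial family does.\<close>

lemma generators_inj: "inj_on x {1..n}"
proof (rule inj_onI)
  fix i j assume ij: "i \<in> {1..n}" "j \<in> {1..n}" "x i = x j"
  then have "standard_monomial n x (unit_exponent n i) = standard_monomial n x (unit_exponent n j)"
    by (simp only: standard_monomial_unit_exponent)
  then have "unit_exponent n i = unit_exponent n j"
    using inj_onD[OF monomials_inj] unit_exponent_in_exponents by blast
  then show "i = j" using ij(1) unit_exponent_eq_iff by blast
qed

lemma generators_coeff_zero:
  assumes ijk: "i \<in> {1..n}" "j \<in> {1..n}" "k \<in> {1..n}" "i \<noteq> j" "i \<noteq> k" "j \<noteq> k"
    and comb: "a *s x i + b *s x j + c *s x k = 0"
  shows "a = 0"
proof -
  have ne: "x i \<noteq> x j" "x i \<noteq> x k" "x j \<noteq> x k"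
    using ijk inj_onD[OF generators_inj] by blast+
  \<comment> \<open>Independence takes coefficients indexed by vectors; \<open>ne\<close> ensures
    that \<open>u\<close> gives each of the three generators its own coefficient.\<close>
  define u where "u v = (if v = x i then a else if v = x j then b else c)" for v
  have "independent (x ` {1..n})"
    using independent_mono[OF monomials_independent generators_in_basis] .
  moreover have "{x i, x j, x k} \<subseteq> x ` {1..n}" using ijk by blast
  moreover have "(\<Sum>v\<in>{x i, x j, x k}. u v *s v) = 0"
    using ne ne[symmetric] comb by (simp add: u_def add.assoc)
  ultimately have "u (x i) = 0"
    by (intro independentD[of "x ` {1..n}" "{x i, x j, x k}" u]) auto
  then show ?thesis by (simp add: u_def)
qed

text \<open>Both ways of reversing \<open>x i * x j * x k\<close> produce
  \<open>x k * (x j * x i)\<close> with the same coefficient \<open>q i j * q i k * q j k\<close>.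
  The cubic terms cancel, leaving a linear relation.\<close>

lemma triple_product_comparison:
  assumes ijk: "i \<in> {1..n}" "j \<in> {1..n}" "k \<in> {1..n}" "i \<noteq> j" "i \<noteq> k" "j \<noteq> k"
  shows "(r j k * (q i j * q i k - 1)) *s x i + (r i k * (q i j - q j k)) *s x j
       + (r i j * (1 - q j k * q i k)) *s x k = 0"
proof -
  note rel = relation[OF ijk(1,2,4)] relation[OF ijk(1,3,5)] relation[OF ijk(2,3,6)]
  note expand = distrib_left distrib_right scale_mult_left scale_mult_right
    scale_right_distrib
  let ?m = "x k * (x j * x i)"
  \<comment> \<open>First way: swap the pairs \<open>i j\<close>, then \<open>i k\<close>, then
    \<open>j k\<close>.\<close>
  have "x i * x j * x k = q i j *s (x j * (x i * x k)) + r i j *s x k"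
    by (simp add: rel(1) expand mult.assoc)
  also have "\<dots> = (q i j * q i k) *s ((x j * x k) * x i) + (q i j * r i k) *s x j + r i j *s x k"
    by (simp add: rel(2) expand mult.assoc)
  also have "\<dots> = (q i j * q i k * q j k) *s ?m + (q i j * q i k * r j k) *s x i
      + (q i j * r i k) *s x j + r i j *s x k"
    by (simp add: rel(3) expand mult.assoc)
  finally have left: "x i * x j * x k = \<dots>" .
  \<comment> \<open>Second way: swap \<open>j k\<close>, then \<open>i k\<close>, then
    \<open>i j\<close>.\<close>
  have "x i * x j * x k = x i * (x j * x k)"
    by (simp add: mult.assoc)
  also have "\<dots> = q j k *s ((x i * x k) * x j) + r j k *s x i"
    by (simp add: rel(3) expand mult.assoc)
  also have "\<dots> = (q j k * q i k) *s (x k * (x i * x j)) + (q j k * r i k) *s x j + r j k *s x i"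
    by (simp add: rel(2) expand mult.assoc)
  also have "\<dots> = (q i j * q i k * q j k) *s ?m + (q j k * q i k * r i j) *s x k
      + (q j k * r i k) *s x j + r j k *s x i"
    by (simp add: rel(1) expand ac_simps)
  finally have "(q i j * q i k * q j k) *s ?m + (q i j * q i k * r j k) *s x i
      + (q i j * r i k) *s x j + r i j *s x k
    = (q i j * q i k * q j k) *s ?m + (q j k * q i k * r i j) *s x k
      + (q j k * r i k) *s x j + r j k *s x i"
    unfolding left .
  then show ?thesis
    by (simp add: algebra_simps)
qed

text \<open>The coefficient of \<open>x i\<close> in the linear relation vanishes, and its factor
  \<open>r j k\<close> can be cancelled.\<close>

lemma q_prod_eq_1:
  assumes "i \<in> {1..n}" "j \<in> {1..n}" "k \<in> {1..n}" "i \<noteq> j" "i \<noteq> k" "j \<noteq> k" "r j k \<noteq> 0"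
  shows "q i j * q i k = 1"
  using generators_coeff_zero[OF assms(1-6) triple_product_comparison[OF assms(1-6)]] assms(7)
  by simp

lemma r_sym: "r j i \<noteq> 0" if "i \<in> {1..n}" "j \<in> {1..n}" "i \<noteq> j" "r i j \<noteq> 0"
  using that r_swap[OF that(1-3)] q_nonzero[OF that(1-3)] by simp

lemma weyl_graph_sym: "sym (parcs (weyl_graph n r))"
  by (rule symI) (auto simp: weyl_graph_def r_sym)

text \<open>Connectedness means strong connectedness of the symmetric closure, which adds no arcs
  here because \<open>r i j\<close> and \<open>r j i\<close> vanish together.\<close>

lemma weyl_graph_rtrancl:
  assumes "u \<in> {1..n}" "v \<in> {1..n}"
  shows "(u, v) \<in> (parcs (weyl_graph n r))\<^sup>*"
proof -
  let ?S = "mk_symmetric (with_proj (weyl_graph n r))"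
  have "u \<rightarrow>\<^sup>*\<^bsub>with_proj ?S\<^esub> v"
    using graph_connected assms
    by (simp add: connected_def strongly_connected_def mk_symmetric_def weyl_graph_def)
  then have "(u, v) \<in> (parcs ?S)\<^sup>*"
    unfolding reachable_def by (auto dest: rtrancl_on_rtranclI)
  moreover have "parcs ?S = parcs (weyl_graph n r)"
    using weyl_graph_sym by (auto simp: mk_symmetric_def dest: symD)
  ultimately show ?thesis by simp
qed

lemma q_values: "\<exists>q\<^sub>0. q\<^sub>0 \<noteq> 0 \<and>
  {q i j | i j. i \<in> {1..n} \<and> j \<in> {1..n} \<and> i \<noteq> j} = {q\<^sub>0, inverse q\<^sub>0}"
proof -
  let ?E = "parcs (weyl_graph n r)"
  have E_iff: "(i, j) \<in> ?E \<longleftrightarrow> i \<in> {1..n} \<and> j \<in> {1..n} \<and> i \<noteq> j \<and> r i j \<noteq> 0" for i j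
    by (simp add: weyl_graph_def)
  \<comment> \<open>Since \<open>n\<close> is at least 2, a walk from 1 to 2 exists and its first
    arc supplies the initial edge \<open>(1, b)\<close>; the witness is
    \<open>q 1 b\<close>.\<close>
  have "(1, 2) \<in> ?E\<^sup>*"
    using weyl_graph_rtrancl n_ge_2 by simp
  then obtain b where b: "(1, b) \<in> ?E"
    by (cases rule: converse_rtranclE) auto
  then have b': "1 \<in> {1..n}" "b \<in> {1..n}" "1 \<noteq> b"
    unfolding E_iff by blast+
  define Q where "Q = {q 1 b, inverse (q 1 b)}"
  have Q_inverse: "inverse c \<in> Q" if "c \<in> Q" for c
    using that by (auto simp: Q_def)
  have "q u v \<in> Q" if "u \<in> {1..n}" "v \<in> {1..n}" "u \<noteq> v" for u v
  proof (rule all_pairs_by_sliding[where E = ?E and V = "{1..n}" and P = "\<lambda>i j. q i j \<in> Q"])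
    show "q j i \<in> Q" if "i \<in> {1..n}" "j \<in> {1..n}" "i \<noteq> j" "q i j \<in> Q" for i j
      using q_swap[OF that(1-3)] Q_inverse[OF that(4)] by simp
    \<comment> \<open>A slide replaces \<open>q i j\<close> by its inverse, and \<open>Q\<close> is
      closed under inversion.\<close>
    show "q i k \<in> Q" if "i \<in> {1..n}" "(j, k) \<in> ?E" "i \<noteq> j" "i \<noteq> k" "q i j \<in> Q" for i j k
    proof -
      have "q i j * q i k = 1"
        using that(1-4) by (intro q_prod_eq_1) (simp_all add: E_iff)
      then show ?thesis
        using Q_inverse[OF that(5)] inverse_unique by metis
    qed
    show "q 1 b \<in> Q" by (simp add: Q_def)
  qed (use that b weyl_graph_sym weyl_graph_rtrancl E_iff in auto)
  then have "{q i j | i j. i \<in> {1..n} \<and> j \<in> {1..n} \<and> i \<noteq> j} \<subseteq> Q"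
    by blast
  \<comment> \<open>Both elements of \<open>Q\<close> are attained, which gives the reverse
    inclusion.\<close>
  moreover have "Q = {q 1 b, q b 1}"
    using q_swap[OF b'] by (simp add: Q_def)
  then have "Q \<subseteq> {q i j | i j. i \<in> {1..n} \<and> j \<in> {1..n} \<and> i \<noteq> j}"
    using b' b'(3)[symmetric] by blast
  ultimately have "{q i j | i j. i \<in> {1..n} \<and> j \<in> {1..n} \<and> i \<noteq> j} = Q"
    by (rule subset_antisym)
  then show ?thesis
    using q_nonzero[OF b'] Q_def by blast
qed

end

theorem corollary2p12:
  fixes scale :: "'k::alg_closed_field \<Rightarrow> 'a::ring_1 \<Rightarrow> 'a"
    and n :: nat
    and x :: "nat \<Rightarrow> 'a"
    and q r :: "nat \<Rightarrow> nat \<Rightarrow> 'k"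
  assumes "connected_quantized_weyl_algebra scale n x q r"
  shows "\<exists>q\<^sub>0::'k. q\<^sub>0 \<noteq> 0 \<and>
           {q i j | i j. i \<in> {1..n} \<and> j \<in> {1..n} \<and> i \<noteq> j} = {q\<^sub>0, inverse q\<^sub>0}"
  using connected_quantized_weyl_algebra.q_values[OF assms] .

end
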